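(* Let $t \ge 3$ be an integer. Then every (finite, simple) graph $G$ that does not contain $K_t$ as an odd minor admits a (not necessarily proper) vertex-coloring $c: V(G)\to S$ with $|S| = 2t-2$ colors such that every monochromatic component has at most $\lceil \frac{1}{2}(t-2) \rceil$ vertices.
   Context: For an integer $t\ge 1$, a $K_t$-expansion is a graph $F$ consisting of $t$ vertex-disjoint trees $T_1,\dots,T_t$ together with, for each pair of distinct trees, exactly one additional edge joining them. A $K_t$-expansion $F$ is odd if there is a $2$-coloring of $V(F)$ whose restriction to each tree $T_s$ is a proper coloring of $T_s$, while every edge joining two distinct trees has both endpoints of the same color. A graph $G$ contains $K_t$ as an odd minor if some subgraph of $G$ is an odd $K_t$-expansion. For a vertex-coloring $c:V(G)\to S$ (not necessarily proper), a monochromatic component is a vertex set that is a connected component of the induced subgraph $G[c^{-1}(s)]$ for some color $s\in S$. *)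

theory Defs
  imports Complex_Main
begin

definition simple_graph :: "'a set \<Rightarrow> 'a set set \<Rightarrow> bool" where
  "simple_graph V E \<longleftrightarrow> finite V \<and>
     (\<forall>e\<in>E. \<exists>x y. e = {x, y} \<and> x \<noteq> y \<and> x \<in> V \<and> y \<in> V)"

definition reach :: "'a set \<Rightarrow> 'a set set \<Rightarrow> 'a \<Rightarrow> 'a \<Rightarrow> bool" where
  "reach W ES u v \<longleftrightarrow> u \<in> W \<and>
     (\<lambda>x y. {x, y} \<in> ES \<and> x \<in> W \<and> y \<in> W)\<^sup>*\<^sup>* u v"

definition connected_graph :: "'a set \<Rightarrow> 'a set set \<Rightarrow> bool" where
  "connected_graph W ES \<longleftrightarrow> (\<forall>u\<in>W. \<forall>v\<in>W. reach W ES u v)"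

definition is_tree :: "'a set \<Rightarrow> 'a set set \<Rightarrow> bool" where
  "is_tree W ES \<longleftrightarrow> finite W \<and> W \<noteq> {} \<and>
     (\<forall>e\<in>ES. \<exists>x y. e = {x, y} \<and> x \<noteq> y \<and> x \<in> W \<and> y \<in> W) \<and>
     connected_graph W ES \<and>
     (\<forall>e\<in>ES. \<not> connected_graph W (ES - {e}))"

definition odd_Kt_minor :: "'a set \<Rightarrow> 'a set set \<Rightarrow> nat \<Rightarrow> bool" where
  "odd_Kt_minor V E t \<longleftrightarrow>
    (\<exists>(T :: nat \<Rightarrow> 'a set) (TE :: nat \<Rightarrow> 'a set set) (X :: nat \<Rightarrow> nat \<Rightarrow> 'a set) (col :: 'a \<Rightarrow> bool).
       (\<forall>s<t. T s \<subseteq> V \<and> TE s \<subseteq> E \<and> is_tree (T s) (TE s)) \<and>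
       (\<forall>s<t. \<forall>s'<t. s \<noteq> s' \<longrightarrow> T s \<inter> T s' = {}) \<and>
       (\<forall>s<t. \<forall>s'<t. s \<noteq> s' \<longrightarrow>
          X s s' = X s' s \<and> X s s' \<in> E \<and>
          (\<exists>x y. X s s' = {x, y} \<and> x \<in> T s \<and> y \<in> T s')) \<and>
       (\<forall>s<t. \<forall>x y. {x, y} \<in> TE s \<longrightarrow> x \<noteq> y \<longrightarrow> col x \<noteq> col y) \<and>
       (\<forall>s<t. \<forall>s'<t. s \<noteq> s' \<longrightarrow> (\<forall>x\<in>X s s'. \<forall>y\<in>X s s'. col x = col y)))"

definition induced_edges :: "'a set set \<Rightarrow> 'a set \<Rightarrow> 'a set set" where
  "induced_edges E W = {e \<in> E. e \<subseteq> W}"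

definition is_component :: "'a set \<Rightarrow> 'a set set \<Rightarrow> 'a set \<Rightarrow> bool" where
  "is_component W ES C \<longleftrightarrow> (\<exists>v\<in>W. C = {u. reach W ES v u})"

definition mono_component :: "'a set \<Rightarrow> 'a set set \<Rightarrow> ('a \<Rightarrow> 'c) \<Rightarrow> 'a set \<Rightarrow> bool" where
  "mono_component V E c C \<longleftrightarrow>
     (\<exists>s. is_component {v \<in> V. c v = s} (induced_edges E {v \<in> V. c v = s}) C)"

end

(* Partition the vertices greedily into parts with a 2-colouring that makes every part connected
   through its bichromatic edges, so that each part carries a properly 2-coloured spanning tree,
   and call two parts adjacent if a monochromatic edge joins them. Invariant: parts touching a
   common component of the uncovered graph are pairwise adjacent. If an uncovered vertex sees a
   single colour of some part, that part absorbs it with the opposite colour, which creates no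
   monochromatic edge inside the part. Otherwise every uncovered vertex that touches a part sees
   both colours of it, so any new part through such a vertex is adjacent to the old one, whatever
   its own colouring. A new part inside an uncovered component that reaches all k parts touching
   it therefore extends a clique of k parts; k >= t - 1 would give an odd K_t minor, so k <= t - 2,
   and the parts can be coloured greedily with t - 1 colour pairs. Such a part can be chosen with
   monochromatic components of at most (k + 1) div 2 vertices. *)

theory Submission
  imports Defs
begin

section \<open>Connectivity\<close>

lemma reach_refl: "u \<in> W \<Longrightarrow> reach W ES u u"
  by (simp add: reach_def)

lemma reach_in: "reach W ES u v \<Longrightarrow> v \<in> W"
  unfolding reach_def by (auto elim: rtranclp.cases)

lemma reach_trans: "reach W ES u v \<Longrightarrow> reach W ES v w \<Longrightarrow> reach W ES u w"
  unfolding reach_def by auto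

lemma reach_edge: "reach W ES u v \<Longrightarrow> {v, w} \<in> ES \<Longrightarrow> w \<in> W \<Longrightarrow> reach W ES u w"
  using reach_in[of W ES u v] unfolding reach_def by (auto intro: rtranclp.rtrancl_into_rtrancl)

text \<open>Induction along a walk, packaged so that later arguments only have to exhibit a closed
  set.\<close>

lemma reach_closed:
  assumes "reach W ES u v" "u \<in> A" "\<And>x y. x \<in> A \<Longrightarrow> y \<in> W \<Longrightarrow> {x, y} \<in> ES \<Longrightarrow> y \<in> A"
  shows "v \<in> A"
proof -
  have "(\<lambda>x y. {x, y} \<in> ES \<and> x \<in> W \<and> y \<in> W)\<^sup>*\<^sup>* u v"
    using assms(1) by (simp add: reach_def)
  then show ?thesis
    by (induction) (use assms(2,3) in auto)
qed

lemma reach_sym: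
  assumes "reach W ES u v" shows "reach W ES v u"
proof -
  have "v \<in> {x. reach W ES x u}"
  proof (rule reach_closed[OF assms])
    show "u \<in> {x. reach W ES x u}"
      using assms by (simp add: reach_def)
    fix x y assume "x \<in> {x. reach W ES x u}" "y \<in> W" "{x, y} \<in> ES"
    then have "reach W ES y x" "reach W ES x u"
      by (auto simp: insert_commute reach_def)
    then show "y \<in> {x. reach W ES x u}"
      using reach_trans by simp
  qed
  then show ?thesis by simp
qed

text \<open>The working form of connectivity: if no edge left \<open>A\<close>, then
  \<open>A\<close> would be closed and no walk from it could reach the rest of
  \<open>W\<close>.\<close>

lemma connected_graph_cut:
  assumes "connected_graph W ES" "A \<subseteq> W" "A \<noteq> {}" "A \<noteq> W"
  obtains x y where "x \<in> A" "y \<in> W - A" "{x, y} \<in> ES"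
proof -
  obtain a b where "a \<in> A" "b \<in> W" "b \<notin> A"
    using assms by blast
  moreover from this have "reach W ES a b"
    using assms by (auto simp: connected_graph_def)
  ultimately show thesis
    using reach_closed[of W ES a b A] that by blast
qed

text \<open>Converse of the cut property, with only the sets avoiding one root to be checked. Apply
  the hypothesis to the set of vertices unreachable from \<open>r\<close>: an edge leaving it would
  make one of its members reachable.\<close>

lemma connected_graph_rootI:
  assumes "r \<in> W" "\<And>A. A \<subseteq> W \<Longrightarrow> r \<notin> A \<Longrightarrow> A \<noteq> {} \<Longrightarrow> \<exists>x\<in>A. \<exists>y\<in>W - A. {x, y} \<in> ES"
  shows "connected_graph W ES"
proof -
  have reach_r: "reach W ES r u" if "u \<in> W" for u
  proof (rule ccontr)
    define A where "A = {u \<in> W. \<not> reach W ES r u}"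
    assume "\<not> reach W ES r u"
    then have "A \<subseteq> W" "r \<notin> A" "A \<noteq> {}"
      using that assms(1) by (auto simp: A_def reach_refl)
    then obtain x y where "x \<in> A" "y \<in> W - A" "{x, y} \<in> ES"
      using assms(2)[of A] by metis
    then have "reach W ES r x"
      using reach_edge[of W ES r y x] by (simp add: A_def insert_commute)
    then show False
      using \<open>x \<in> A\<close> by (simp add: A_def)
  qed
  then show ?thesis
    unfolding connected_graph_def
    by (intro ballI reach_trans[OF reach_sym[OF reach_r] reach_r])
qed

lemma connected_graph_empty: "connected_graph {} ES"
  by (simp add: connected_graph_def)

lemma connected_graph_singleton: "connected_graph {x} ES"
  by (simp add: connected_graph_def reach_refl)

text \<open>Only edges inside \<open>W\<close> matter. This is how connectivity is carried over to a
  colouring that agrees on \<open>W\<close>, or to another edge set.\<close>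

lemma connected_graph_cong:
  assumes "connected_graph W ES" "\<And>x y. x \<in> W \<Longrightarrow> y \<in> W \<Longrightarrow> {x, y} \<in> ES \<Longrightarrow> {x, y} \<in> ES'"
  shows "connected_graph W ES'"
proof (cases "W = {}")
  case False
  then obtain r where "r \<in> W" by blast
  then show ?thesis
  proof (rule connected_graph_rootI)
    fix A assume A: "A \<subseteq> W" "r \<notin> A" "A \<noteq> {}"
    then have "A \<noteq> W"
      using \<open>r \<in> W\<close> by blast
    then obtain x y where "x \<in> A" "y \<in> W - A" "{x, y} \<in> ES"
      using connected_graph_cut[OF assms(1)] A by metis
    then show "\<exists>x\<in>A. \<exists>y\<in>W - A. {x, y} \<in> ES'"
      using assms(2) A by blast
  qed
qed (simp add: connected_graph_empty)

lemma connected_graph_Un: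
  assumes "connected_graph A ES" "connected_graph B ES" "v \<in> A" "v \<in> B"
  shows "connected_graph (A \<union> B) ES"
proof (rule connected_graph_rootI[of v])
  fix D assume D: "D \<subseteq> A \<union> B" "v \<notin> D" "D \<noteq> {}"
  have *: "\<exists>x\<in>D. \<exists>y\<in>A \<union> B - D. {x, y} \<in> ES"
    if K: "connected_graph K ES" "K \<subseteq> A \<union> B" "v \<in> K" "D \<inter> K \<noteq> {}" for K
  proof -
    have "D \<inter> K \<subseteq> K" "D \<inter> K \<noteq> K"
      using K D by auto
    then obtain x y where "x \<in> D \<inter> K" "y \<in> K - D \<inter> K" "{x, y} \<in> ES"
      using connected_graph_cut[OF K(1)] K(4) by metis
    then show ?thesis
      using K(2) by blast
  qed
  have "D \<inter> A \<noteq> {} \<or> D \<inter> B \<noteq> {}"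
    using D by blast
  then show "\<exists>x\<in>D. \<exists>y\<in>A \<union> B - D. {x, y} \<in> ES"
    using *[of A] *[of B] assms by blast
qed (use assms in auto)

lemma connected_graph_pair: "{x, y} \<in> ES \<Longrightarrow> connected_graph {x, y} ES"
proof (rule connected_graph_rootI[of x])
  fix A assume A: "{x, y} \<in> ES" "A \<subseteq> {x, y}" "x \<notin> A" "A \<noteq> {}"
  then have "A = {y}" by blast
  moreover from A have "{y, x} \<in> ES" by (simp add: insert_commute)
  ultimately show "\<exists>a\<in>A. \<exists>b\<in>{x, y} - A. {a, b} \<in> ES"
    using A(3) by auto
qed simp

lemma connected_graph_insert:
  assumes "connected_graph W ES" "w \<in> W" "{w, v} \<in> ES"
  shows "connected_graph (insert v W) ES"
proof -
  have "insert v W = W \<union> {w, v}"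
    using assms(2) by blast
  then show ?thesis
    using connected_graph_Un[OF assms(1) connected_graph_pair[OF assms(3)], of w] assms(2) by simp
qed

text \<open>Walks inside \<open>W\<close> need not leave the component: an edge of \<open>W\<close>
  that leaves a subset of it ends in a vertex that is reachable from \<open>v\<close> as
  well.\<close>

lemma connected_graph_component: "connected_graph {u. reach W ES v u} ES"
proof (cases "v \<in> W")
  case True
  let ?C = "{u. reach W ES v u}"
  show ?thesis
  proof (rule connected_graph_rootI[of v])
    fix A assume A: "A \<subseteq> ?C" "v \<notin> A" "A \<noteq> {}"
    then obtain a where a: "a \<in> A" "reach W ES a v"
      by (auto dest: reach_sym)
    have "\<exists>x\<in>A. \<exists>y\<in>W. y \<notin> A \<and> {x, y} \<in> ES"
      using reach_closed[OF a(2) a(1)] A(2) by blast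
    then show "\<exists>x\<in>A. \<exists>y\<in>?C - A. {x, y} \<in> ES"
      using A(1) reach_edge by fast
  qed (simp add: True reach_refl)
next
  case False
  then show ?thesis
    by (simp add: reach_def connected_graph_empty)
qed

text \<open>The component of \<open>w\<close> in \<open>X - {v}\<close> must have an edge to the
  rest of \<open>X\<close>, and that edge can only go to \<open>v\<close>.\<close>

lemma connected_graph_delete_nbr:
  assumes "connected_graph X ES" "v \<in> X" "w \<in> X" "w \<noteq> v"
  obtains y where "reach (X - {v}) ES w y" "{y, v} \<in> ES"
proof -
  let ?Y = "{u. reach (X - {v}) ES w u}"
  have "?Y \<subseteq> X - {v}"
    using reach_in by fast
  moreover have "w \<in> ?Y"
    using assms by (simp add: reach_refl)
  ultimately have "?Y \<subseteq> X" "?Y \<noteq> {}" "?Y \<noteq> X"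
    using assms by blast+
  then obtain x y where xy: "x \<in> ?Y" "y \<in> X - ?Y" "{x, y} \<in> ES"
    using connected_graph_cut[OF assms(1)] by metis
  then have "y = v"
    using reach_edge[of "X - {v}" ES w x y] by auto
  then show thesis
    using xy that by auto
qed

section \<open>Bichromatic edges and monochromatic connected sets\<close>

definition cut_edges :: "'a set set \<Rightarrow> ('a \<Rightarrow> bool) \<Rightarrow> 'a set set" where
  "cut_edges E c = {e \<in> E. \<exists>x y. e = {x, y} \<and> c x \<noteq> c y}"

lemma doubleton_in_cut_edges [simp]: "{x, y} \<in> cut_edges E c \<longleftrightarrow> {x, y} \<in> E \<and> c x \<noteq> c y"
  by (auto simp: cut_edges_def doubleton_eq_iff)

text \<open>Maximality is deliberately not demanded: a size bound on all such sets passes to smaller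
  ground sets and still covers the monochromatic components.\<close>

definition mono_connected :: "'a set set \<Rightarrow> ('a \<Rightarrow> bool) \<Rightarrow> 'a set \<Rightarrow> bool" where
  "mono_connected E c X \<longleftrightarrow> connected_graph X E \<and> (\<forall>x\<in>X. \<forall>y\<in>X. c x = c y)"

lemma mono_connected_cong:
  "mono_connected E c X \<Longrightarrow> (\<And>x. x \<in> X \<Longrightarrow> c x = d x) \<Longrightarrow> mono_connected E d X"
  unfolding mono_connected_def by metis

section \<open>Balanced bichromatically connected colourings\<close>

text \<open>The root bound rounds down so that gluing two colourings at the root of one of them does
  not exceed the rounded-up bound for the union.\<close>

definition balanced :: "'a set set \<Rightarrow> ('a \<Rightarrow> bool) \<Rightarrow> 'a set \<Rightarrow> 'a \<Rightarrow> nat \<Rightarrow> bool" where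
  "balanced E c W r k \<longleftrightarrow> r \<in> W \<and> connected_graph W (cut_edges E c) \<and>
     (\<forall>X\<subseteq>W. mono_connected E c X \<longrightarrow>
        card X \<le> (k + 1) div 2 \<and> (r \<in> X \<longrightarrow> card X \<le> k div 2))"

text \<open>If all neighbours of the new vertex have one colour, the opposite colour is safe. Otherwise
  either colour keeps the set bichromatically connected, and the one whose components meeting the
  new vertex are smaller in total is taken; a tie is broken against the colour of the root.\<close>

lemma balanced_insert:
  assumes bal: "balanced E c W r k" and fin: "finite W" and "card W < k" "2 \<le> k"
    and vw: "w \<in> W" "v \<notin> W" "{w, v} \<in> E"
  obtains d where "balanced E d (insert v W) r k"
proof -
  \<comment> \<open>\<open>A a\<close> collects the connected sets of colour \<open>a\<close> in
    \<open>W\<close> that have a neighbour of \<open>v\<close>, that is, everything a monochromatic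
    connected set through \<open>v\<close> could contain besides \<open>v\<close> if
    \<open>v\<close> received colour \<open>a\<close>.\<close>
  define A where "A a = {u \<in> W. \<exists>Y\<subseteq>W. connected_graph Y E \<and> (\<forall>y\<in>Y. c y = a) \<and> u \<in> Y \<and>
    (\<exists>y\<in>Y. {y, v} \<in> E)}" for a
  have A_col: "c u = a" if "u \<in> A a" for u a
    using that by (auto simp: A_def)
  have A_W: "A a \<subseteq> W" for a
    by (auto simp: A_def)
  have "card (A True) + card (A False) = card (A True \<union> A False)"
    using A_col[of _ True] A_col[of _ False] finite_subset[OF A_W fin]
    by (intro card_Un_disjoint[symmetric]) blast+
  also have "\<dots> \<le> card W"
    using A_W fin by (intro card_mono) auto
  finally have sum: "card (A True) + card (A False) < k"
    using assms(3) by linarith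
  have "r \<in> W"
    using bal by (simp add: balanced_def)
  \<comment> \<open>The colour \<open>a\<close> is meant for \<open>v\<close>. A neighbour of the
    other colour attaches \<open>v\<close> by a bichromatic edge, and \<open>1 + card (A a)\<close>
    bounds every monochromatic connected set through \<open>v\<close>.\<close>
  have "\<exists>a. (\<exists>u\<in>W. {u, v} \<in> E \<and> c u \<noteq> a) \<and> 1 + card (A a) \<le> (k + 1) div 2 \<and>
      (r \<in> A a \<longrightarrow> 1 + card (A a) \<le> k div 2)"
  proof (cases "\<exists>u\<in>W. {u, v} \<in> E \<and> c u \<noteq> c w")
    case False
    have "A (\<not> c w) = {}"
    proof (rule equals0I)
      fix u assume "u \<in> A (\<not> c w)"
      then obtain y where "y \<in> W" "{y, v} \<in> E" "c y = (\<not> c w)"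
        unfolding A_def by blast
      then have "y \<in> W \<and> {y, v} \<in> E \<and> c y \<noteq> c w" by simp
      then show False using False by blast
    qed
    then show ?thesis
      using vw \<open>2 \<le> k\<close> by (intro exI[of _ "\<not> c w"] conjI bexI[of _ w]) simp_all
  next
    case True
    then have nbr: "\<exists>u\<in>W. {u, v} \<in> E \<and> c u \<noteq> a" for a
      using vw by (cases "c w = a") metis+
    have "\<exists>a. 1 + card (A a) \<le> (k + 1) div 2 \<and> (r \<in> A a \<longrightarrow> 1 + card (A a) \<le> k div 2)"
    proof -
      \<comment> \<open>If the sizes differ, the smaller one satisfies
        \<open>2 * card (A a) + 2 \<le> k\<close>, which suffices even for the root bound. If they
        agree, only \<open>(k + 1) div 2\<close> is certain, so the root must be kept out.\<close>
      consider "card (A True) < card (A False)" | "card (A False) < card (A True)"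
        | "card (A True) = card (A False)"
        by linarith
      then show ?thesis
      proof cases
        case 1
        then show ?thesis using sum by (intro exI[of _ True]) linarith
      next
        case 2
        then show ?thesis using sum by (intro exI[of _ False]) linarith
      next
        case 3
        have "r \<notin> A (\<not> c r)"
          using A_col by blast
        moreover have "1 + card (A (\<not> c r)) \<le> (k + 1) div 2"
          using 3 sum by (cases "c r") auto
        ultimately show ?thesis by blast
      qed
    qed
    then obtain a where "1 + card (A a) \<le> (k + 1) div 2 \<and> (r \<in> A a \<longrightarrow> 1 + card (A a) \<le> k div 2)" ..
    then show ?thesis using nbr[of a] by (intro exI[of _ a] conjI) simp_all
  qed
  then obtain a where a: "\<exists>u\<in>W. {u, v} \<in> E \<and> c u \<noteq> a" "1 + card (A a) \<le> (k + 1) div 2"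
    "r \<in> A a \<longrightarrow> 1 + card (A a) \<le> k div 2"
    by metis
  define d where "d = c(v := a)"
  have dc: "d x = c x" if "x \<in> W" for x
    using that vw by (auto simp: d_def)
  have "connected_graph W (cut_edges E d)"
  proof (rule connected_graph_cong)
    show "connected_graph W (cut_edges E c)"
      using bal by (simp add: balanced_def)
  qed (simp add: dc)
  moreover obtain u where "u \<in> W" "{u, v} \<in> E" "c u \<noteq> a"
    using a(1) by metis
  ultimately have conn: "connected_graph (insert v W) (cut_edges E d)"
    using dc by (intro connected_graph_insert[of _ _ u]) (simp_all add: d_def)
  have "card X \<le> (k + 1) div 2 \<and> (r \<in> X \<longrightarrow> card X \<le> k div 2)"
    if X: "X \<subseteq> insert v W" "mono_connected E d X" for X
  proof (cases "v \<in> X")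
    case False
    then have "X \<subseteq> W" using X by blast
    moreover from this have "mono_connected E c X"
      using dc by (intro mono_connected_cong[OF X(2)]) blast
    ultimately show ?thesis
      using bal unfolding balanced_def by blast
  next
    case True
    \<comment> \<open>Deleting \<open>v\<close> from \<open>X\<close> leaves connected pieces of
      colour \<open>a\<close>, each with a neighbour of \<open>v\<close>.\<close>
    have XA: "X - {v} \<subseteq> A a"
    proof
      fix u assume u: "u \<in> X - {v}"
      obtain y where y: "reach (X - {v}) E u y" "{y, v} \<in> E"
        using connected_graph_delete_nbr[of X E v u] X(2) True u unfolding mono_connected_def by blast
      let ?Y = "{z. reach (X - {v}) E u z}"
      have "?Y \<subseteq> X - {v}"
        using reach_in by fast
      moreover have "c z = a" if "z \<in> X - {v}" for z
      proof -
        have "d z = d v"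
          using X(2) True that unfolding mono_connected_def by fast
        then show ?thesis
          using that by (simp add: d_def)
      qed
      ultimately have "?Y \<subseteq> W \<and> connected_graph ?Y E \<and> (\<forall>z\<in>?Y. c z = a) \<and> u \<in> ?Y \<and>
          (\<exists>z\<in>?Y. {z, v} \<in> E)"
        using y reach_refl[OF u] X(1) by (intro conjI connected_graph_component) blast+
      then show "u \<in> A a"
        unfolding A_def by blast
    qed
    moreover have "finite (A a)"
      using A_W fin by (rule finite_subset)
    ultimately have "card (X - {v}) \<le> card (A a)"
      by (intro card_mono)
    moreover have "card X = 1 + card (X - {v})"
      using card.remove[OF finite_subset[OF X(1)] True] fin by simp
    moreover have "r \<in> X \<longrightarrow> r \<in> A a"
      using XA \<open>r \<in> W\<close> vw by blast
    ultimately show ?thesis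
      using a(2,3) by linarith
  qed
  then have "balanced E d (insert v W) r k"
    unfolding balanced_def using conn \<open>r \<in> W\<close> by blast
  then show thesis
    by (rule that)
qed

text \<open>Grow from \<open>{r}\<close> one vertex at a time. Before each step the current set has
  fewer than \<open>card S \<le> k\<close> vertices, as the insertion lemma requires.\<close>

lemma balanced_exists:
  assumes "finite S" "connected_graph S E" "r \<in> S" "card S \<le> k" "2 \<le> k"
  obtains c where "balanced E c S r k"
proof -
  define P where "P n \<longleftrightarrow> (\<exists>W c. W \<subseteq> S \<and> card W = n \<and> balanced E c W r k)" for n
  have base: "P 1"
  proof -
    have "card X \<le> k div 2" if "X \<subseteq> {r}" for X
    proof -
      have "card X \<le> 1"
        using card_mono[OF _ that] by simp
      then show ?thesis
        using assms(5) by linarith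
    qed
    moreover have "k div 2 \<le> (k + 1) div 2"
      by (rule div_le_mono) simp
    ultimately have "\<forall>X\<subseteq>{r}. card X \<le> (k + 1) div 2 \<and> card X \<le> k div 2"
      using order_trans by blast
    then have "balanced E (\<lambda>_. True) {r} r k"
      unfolding balanced_def by (simp add: connected_graph_singleton)
    then show ?thesis
      unfolding P_def using assms(3) by (intro exI[of _ "{r}"]) auto
  qed
  have step: "P (Suc n)" if "P n" "n < card S" for n
  proof -
    obtain W c where W: "W \<subseteq> S" "card W = n" "balanced E c W r k"
      using \<open>P n\<close> unfolding P_def by blast
    then have "W \<noteq> S" "W \<noteq> {}"
      using that unfolding balanced_def by auto
    then obtain w v where wv: "w \<in> W" "v \<in> S - W" "{w, v} \<in> E"
      using connected_graph_cut[OF assms(2) W(1)] by metis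
    have "finite W"
      using W assms finite_subset by blast
    moreover have "card W < k"
      using W that assms by simp
    ultimately obtain d where "balanced E d (insert v W) r k"
      using balanced_insert[of E c W r k w v] W wv assms by blast
    moreover have "insert v W \<subseteq> S" "card (insert v W) = Suc n"
      using W wv \<open>finite W\<close> by simp_all
    ultimately show ?thesis
      unfolding P_def by blast
  qed
  have "1 \<le> card S"
    using assms(1,3) by (simp add: Suc_le_eq card_gt_0_iff) blast
  then have "P (card S)"
    by (rule dec_induct) (use base step in auto)
  then obtain W c where "W \<subseteq> S" "card W = card S" "balanced E c W r k"
    unfolding P_def by blast
  then show thesis
    using that card_subset_eq[OF assms(1)] by blast
qed

section \<open>Gluing at a cut vertex, and balanced hulls of terminal sets\<close>

text \<open>Within \<open>X\<close> the two sides communicate only through \<open>v\<close>, so an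
  edge of \<open>X\<close> leaving a subset of \<open>A - {v}\<close> ends in
  \<open>A\<close>.\<close>

lemma connected_graph_Int_separated:
  assumes "connected_graph X ES" "v \<in> X" "X \<subseteq> A \<union> B" "A \<inter> B \<subseteq> {v}" "v \<in> A"
    and "\<And>x y. x \<in> A - {v} \<Longrightarrow> y \<in> B - {v} \<Longrightarrow> {x, y} \<notin> ES"
  shows "connected_graph (X \<inter> A) ES"
proof (rule connected_graph_rootI[of v])
  fix D assume D: "D \<subseteq> X \<inter> A" "v \<notin> D" "D \<noteq> {}"
  then have "D \<subseteq> X" "D \<noteq> X"
    using assms(2) by blast+
  then obtain x y where xy: "x \<in> D" "y \<in> X - D" "{x, y} \<in> ES"
    using connected_graph_cut[OF assms(1)] D(3) by metis
  then have "y \<in> A"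
    using assms(3,5) assms(6)[of x y] D by blast
  then show "\<exists>x\<in>D. \<exists>y\<in>X \<inter> A - D. {x, y} \<in> ES"
    using xy by blast
qed (use assms in simp)

text \<open>The colourings can be made to agree at \<open>v\<close>, since complementing one changes
  neither its bichromatic edges nor its monochromatic sets. A monochromatic connected set that lies
  in neither side contains \<open>v\<close> and splits there into two connected halves.\<close>

lemma balanced_glue:
  assumes b1: "balanced E c1 W1 r k1" and b2: "balanced E c2 W2 v k2"
    and fin: "finite W1" "finite W2" and Int: "W1 \<inter> W2 = {v}"
    and sep: "\<And>x y. x \<in> W1 - {v} \<Longrightarrow> y \<in> W2 - {v} \<Longrightarrow> {x, y} \<notin> E"
    and k: "k1 + k2 = k + 2" "2 \<le> k1" "2 \<le> k2" and r: "r \<notin> W2"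
  obtains c where "balanced E c (W1 \<union> W2) r k"
proof -
  \<comment> \<open>The equation between Booleans leaves \<open>c2\<close> unchanged if the
    colourings agree at \<open>v\<close> and complements it otherwise.\<close>
  define c where "c x = (if x \<in> W1 then c1 x else c2 x = (c1 v = c2 v))" for x
  have c_1: "c x = c1 x" if "x \<in> W1" for x
    using that by (simp add: c_def)
  have c_2: "c x = (c2 x = (c1 v = c2 v))" if "x \<in> W2" for x
  proof (cases "x \<in> W1")
    case True
    then have "x = v" using Int that by blast
    then show ?thesis by (auto simp: c_def)
  qed (simp add: c_def)
  have v: "v \<in> W1" "v \<in> W2"
    using Int by blast+
  have "connected_graph W1 (cut_edges E c)"
  proof (rule connected_graph_cong)
    show "connected_graph W1 (cut_edges E c1)"
      using b1 by (simp add: balanced_def)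
  qed (simp add: c_1)
  moreover have "connected_graph W2 (cut_edges E c)"
  proof (rule connected_graph_cong)
    show "connected_graph W2 (cut_edges E c2)"
      using b2 by (simp add: balanced_def)
  next
    fix x y assume "x \<in> W2" "y \<in> W2" "{x, y} \<in> cut_edges E c2"
    then show "{x, y} \<in> cut_edges E c"
      using c_2 by (cases "c1 v = c2 v") simp_all
  qed
  ultimately have conn: "connected_graph (W1 \<union> W2) (cut_edges E c)"
    using v by (rule connected_graph_Un)
  have bound1: "card X \<le> (k1 + 1) div 2" "r \<in> X \<Longrightarrow> card X \<le> k1 div 2"
    if "X \<subseteq> W1" "mono_connected E c X" for X
  proof -
    have "mono_connected E c1 X"
      using that c_1 by (intro mono_connected_cong[OF that(2)]) blast
    then show "card X \<le> (k1 + 1) div 2" "r \<in> X \<Longrightarrow> card X \<le> k1 div 2"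
      using b1 that(1) unfolding balanced_def by blast+
  qed
  have bound2: "card X \<le> (k2 + 1) div 2" "v \<in> X \<Longrightarrow> card X \<le> k2 div 2"
    if "X \<subseteq> W2" "mono_connected E c X" for X
  proof -
    have "c2 x = c2 y" if "x \<in> X" "y \<in> X" for x y
    proof -
      have "c x = c y"
        using \<open>mono_connected E c X\<close> that unfolding mono_connected_def by fast
      moreover have "x \<in> W2" "y \<in> W2"
        using that \<open>X \<subseteq> W2\<close> by blast+
      ultimately show ?thesis
        using c_2 by (cases "c1 v = c2 v") simp_all
    qed
    then have "mono_connected E c2 X"
      using that(2) unfolding mono_connected_def by blast
    then show "card X \<le> (k2 + 1) div 2" "v \<in> X \<Longrightarrow> card X \<le> k2 div 2"
      using b2 that(1) unfolding balanced_def by blast+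
  qed
  have "card X \<le> (k + 1) div 2 \<and> (r \<in> X \<longrightarrow> card X \<le> k div 2)"
    if X: "X \<subseteq> W1 \<union> W2" "mono_connected E c X" for X
  proof -
    have Xc: "connected_graph X E"
      using X(2) by (simp add: mono_connected_def)
    consider "X \<subseteq> W1" | "X \<subseteq> W2" | "\<not> X \<subseteq> W1" "\<not> X \<subseteq> W2"
      by blast
    then show ?thesis
    proof cases
      case 1
      have "(k1 + 1) div 2 \<le> (k + 1) div 2" "k1 div 2 \<le> k div 2"
        using k by simp_all
      then show ?thesis
        using bound1[OF 1 X(2)] by linarith
    next
      case 2
      have "(k2 + 1) div 2 \<le> (k + 1) div 2"
        using k by simp
      then show ?thesis
        using bound2(1)[OF 2 X(2)] r 2 by auto
    next
      case 3
      have "v \<in> X"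
      proof (rule ccontr)
        assume "v \<notin> X"
        have "X \<inter> W1 \<noteq> {}" "X \<inter> W1 \<noteq> X" "X \<inter> W1 \<subseteq> X"
          using 3 X(1) by blast+
        then obtain x y where "x \<in> X \<inter> W1" "y \<in> X - X \<inter> W1" "{x, y} \<in> E"
          using connected_graph_cut[OF Xc] by metis
        then show False
          using sep[of x y] X(1) \<open>v \<notin> X\<close> by blast
      qed
      have "connected_graph (X \<inter> W1) E"
        using Xc \<open>v \<in> X\<close> X(1) Int v sep by (intro connected_graph_Int_separated[of X E v W1 W2]) auto
      moreover have "connected_graph (X \<inter> W2) E"
      proof (rule connected_graph_Int_separated[OF Xc \<open>v \<in> X\<close>])
        show "{x, y} \<notin> E" if "x \<in> W2 - {v}" "y \<in> W1 - {v}" for x y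
          using sep[of y x] that by (simp add: insert_commute)
        show "X \<subseteq> W2 \<union> W1" "W2 \<inter> W1 \<subseteq> {v}" "v \<in> W2"
          using X(1) Int v by blast+
      qed
      ultimately have "mono_connected E c (X \<inter> W1)" "mono_connected E c (X \<inter> W2)"
        using X(2) unfolding mono_connected_def by blast+
      then have b: "card (X \<inter> W1) \<le> (k1 + 1) div 2" "r \<in> X \<inter> W1 \<Longrightarrow> card (X \<inter> W1) \<le> k1 div 2"
        "card (X \<inter> W2) \<le> k2 div 2"
        using bound1[of "X \<inter> W1"] bound2[of "X \<inter> W2"] v \<open>v \<in> X\<close> by blast+
      have "X \<inter> W1 \<union> X \<inter> W2 = X" "(X \<inter> W1) \<inter> (X \<inter> W2) = {v}"
        using X(1) Int \<open>v \<in> X\<close> by blast+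
      \<comment> \<open>The halves share only \<open>v\<close>. As \<open>v\<close> is the root of
        the second side, that half obeys the rounded-down bound, and \<open>k1 + k2 = k + 2\<close>
        pays for counting \<open>v\<close> twice.\<close>
      then have "card X + 1 = card (X \<inter> W1) + card (X \<inter> W2)"
        using card_Un_Int[of "X \<inter> W1" "X \<inter> W2"] fin by simp
      moreover have "(k1 + 1) div 2 + k2 div 2 \<le> (k + 1) div 2 + 1" "k1 div 2 + k2 div 2 \<le> k div 2 + 1"
        using k by linarith+
      moreover have "r \<in> X \<Longrightarrow> r \<in> X \<inter> W1"
        using X(1) r by blast
      ultimately have "card X \<le> (k + 1) div 2" "r \<in> X \<Longrightarrow> card X \<le> k div 2"
        using b by linarith+
      then show ?thesis by blast
    qed
  qed
  moreover have "r \<in> W1"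
    using b1 by (simp add: balanced_def)
  ultimately have "balanced E c (W1 \<union> W2) r k"
    unfolding balanced_def using conn by blast
  then show thesis
    by (rule that)
qed

text \<open>A vertex outside \<open>S\<close> is either dispensable or a cut vertex; in the latter case both sides,
  with the cut vertex as an additional terminal, are treated separately and glued.\<close>

lemma balanced_hull:
  assumes "finite H" "connected_graph H E" "S \<subseteq> H" "r \<in> S" "card S = k" "2 \<le> k"
  shows "\<exists>W c. S \<subseteq> W \<and> W \<subseteq> H \<and> balanced E c W r k"
  using assms
proof (induction "card H" arbitrary: H S r k rule: less_induct)
  case less
  show ?case
  proof (cases "S = H")
    case True
    then obtain c where "balanced E c S r k"
      using balanced_exists[of S E r k] less.prems by blast
    then show ?thesis
      using True by blast
  next
    case False
    then obtain v where v: "v \<in> H" "v \<notin> S"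
      using less.prems(3) by blast
    define D where "D = {u. reach (H - {v}) E r u}"
    have r: "r \<in> H" "r \<noteq> v" "r \<in> D"
      using less.prems v by (auto simp: D_def intro: reach_refl)
    have D: "D \<subseteq> H - {v}"
      using reach_in unfolding D_def by fast
    have conn_D: "connected_graph D E"
      unfolding D_def by (rule connected_graph_component)
    have closed: "{x, y} \<notin> E" if "x \<in> D" "y \<in> H - {v} - D" for x y
      using that reach_edge[of "H - {v}" E r x y] by (auto simp: D_def)
    have "finite D"
      using D less.prems(1) finite_subset by blast
    show ?thesis
    proof (cases "S \<subseteq> D")
      \<comment> \<open>The component \<open>D\<close> of \<open>r\<close> holds all terminals, so
        \<open>v\<close> and the other components of \<open>H - {v}\<close> can be
        discarded.\<close>
      case True
      have "card D < card H"
        using D v(1) less.prems(1) by (intro psubset_card_mono) auto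
      then obtain W c where "S \<subseteq> W \<and> W \<subseteq> D \<and> balanced E c W r k"
        using less.hyps[of D S r k] \<open>finite D\<close> conn_D True less.prems by blast
      then show ?thesis
        using D by blast
    next
      case False
      then obtain s where s: "s \<in> S" "s \<notin> D" by blast
      \<comment> \<open>\<open>H2\<close> keeps \<open>v\<close> and all other components of
        \<open>H - {v}\<close>, so it meets \<open>insert v D\<close> only in
        \<open>v\<close>.\<close>
      define H2 where "H2 = H - D"
      have conn1: "connected_graph (insert v D) E"
      proof -
        have "D \<subseteq> H" "D \<noteq> {}" "D \<noteq> H"
          using D r v by blast+
        then obtain x y where "x \<in> D" "y \<in> H - D" "{x, y} \<in> E"
          using connected_graph_cut[OF less.prems(2)] by metis
        moreover from this have "y = v"
          using closed[of x y] by blast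
        ultimately show ?thesis
          using connected_graph_insert[OF conn_D] by blast
      qed
      have conn2: "connected_graph H2 E"
      proof (rule connected_graph_rootI[of v])
        show "v \<in> H2"
          using v D by (auto simp: H2_def)
        fix A assume A: "A \<subseteq> H2" "v \<notin> A" "A \<noteq> {}"
        then have "A \<subseteq> H" "A \<noteq> H"
          using v by (auto simp: H2_def)
        then obtain x y where xy: "x \<in> A" "y \<in> H - A" "{x, y} \<in> E"
          using connected_graph_cut[OF less.prems(2)] A(3) by metis
        have "x \<in> H - {v} - D"
          using xy A by (auto simp: H2_def)
        then have "y \<notin> D"
          using closed[of y x] xy(3) by (auto simp: insert_commute)
        then show "\<exists>x\<in>A. \<exists>y\<in>H2 - A. {x, y} \<in> E"
          using xy by (auto simp: H2_def)
      qed
      have "finite S"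
        using less.prems finite_subset by blast
      \<comment> \<open>Both sides receive \<open>v\<close> as an additional terminal, whence
        \<open>k1 + k2 = k + 2\<close>. Each also keeps an old terminal, \<open>r\<close> or
        \<open>s\<close>, so both counts are at least 2.\<close>
      define k1 where "k1 = card (insert v (S \<inter> D))"
      define k2 where "k2 = card (insert v (S - D))"
      have k1: "k1 = Suc (card (S \<inter> D))" and k2: "k2 = Suc (card (S - D))"
        using v \<open>finite S\<close> by (simp_all add: k1_def k2_def)
      have "card (S \<inter> D) \<noteq> 0" "card (S - D) \<noteq> 0"
        using \<open>finite S\<close> r less.prems(4) s by (auto simp: card_eq_0_iff)
      moreover have "card (S \<inter> D) + card (S - D) = k"
        using card_Int_Diff[OF \<open>finite S\<close>, of D] less.prems(5) by simp
      ultimately have k: "k1 + k2 = k + 2" "2 \<le> k1" "2 \<le> k2"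
        by (auto simp: k1 k2)
      have "card (insert v D) < card H"
        using less.prems(1,3) D v s by (intro psubset_card_mono) auto
      then obtain W1 c1 where W1: "insert v (S \<inter> D) \<subseteq> W1" "W1 \<subseteq> insert v D" "balanced E c1 W1 r k1"
        using less.hyps[of "insert v D" "insert v (S \<inter> D)" r k1] \<open>finite D\<close> conn1 k less.prems(4) r
        by (auto simp: k1_def)
      have "card H2 < card H"
        using less.prems(1) r by (intro psubset_card_mono) (auto simp: H2_def)
      moreover have "finite H2" "insert v (S - D) \<subseteq> H2"
        using less.prems(1,3) v D by (auto simp: H2_def)
      ultimately obtain W2 c2 where W2: "insert v (S - D) \<subseteq> W2" "W2 \<subseteq> H2" "balanced E c2 W2 v k2"
        using less.hyps[of H2 "insert v (S - D)" v k2] conn2 k by (auto simp: k2_def)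
      have "W1 \<inter> W2 = {v}" "r \<notin> W2"
        using W1 W2 r by (auto simp: H2_def)
      moreover have "{x, y} \<notin> E" if "x \<in> W1 - {v}" "y \<in> W2 - {v}" for x y
        using that W1(2) W2(2) by (intro closed) (auto simp: H2_def)
      moreover have "finite W1" "finite W2"
        using W1(2) W2(2) \<open>finite D\<close> \<open>finite H2\<close> by (auto intro: finite_subset)
      ultimately obtain c where "balanced E c (W1 \<union> W2) r k"
        using balanced_glue[OF W1(3) W2(3) _ _ _ _ k] by metis
      moreover have "S \<subseteq> W1 \<union> W2" "W1 \<union> W2 \<subseteq> H"
        using W1 W2 D v by (auto simp: H2_def)
      ultimately show ?thesis by blast
    qed
  qed
qed

text \<open>The root served only the induction and is dropped here. A single terminal is treated
  apart because balanced hulls were built for at least two.\<close>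

lemma clustered_hull:
  assumes "finite H" "connected_graph H E" "S \<subseteq> H" "S \<noteq> {}"
  obtains W c where "S \<subseteq> W" "W \<subseteq> H" "connected_graph W (cut_edges E c)"
    "\<And>X. X \<subseteq> W \<Longrightarrow> mono_connected E c X \<Longrightarrow> card X \<le> (card S + 1) div 2"
proof (cases "card S = 1")
  case True
  then obtain x where "S = {x}"
    by (rule card_1_singletonE)
  then have "connected_graph S (cut_edges E (\<lambda>_. True))"
    by (simp add: connected_graph_singleton)
  moreover have "card X \<le> (card S + 1) div 2" if "X \<subseteq> S" for X
  proof -
    have "card X \<le> card S"
      using that \<open>S = {x}\<close> by (intro card_mono) simp_all
    then show ?thesis
      using True by simp
  qed
  ultimately show thesis
    by (rule that[OF order_refl assms(3)])
next
  case False
  obtain r where "r \<in> S"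
    using assms(4) by blast
  have "card S \<noteq> 0"
    using finite_subset[OF assms(3,1)] \<open>r \<in> S\<close> by (auto simp: card_eq_0_iff)
  with False have "2 \<le> card S" by linarith
  then obtain W c where "S \<subseteq> W" "W \<subseteq> H" "balanced E c W r (card S)"
    using balanced_hull[OF assms(1-3) \<open>r \<in> S\<close> refl] by blast
  then show thesis
    by (intro that[of W c]) (simp_all add: balanced_def)
qed

section \<open>Odd minors from monochromatically adjacent parts\<close>

text \<open>A connected edge set of least cardinality is also edge-minimal, and that is how
  \<open>is_tree\<close> excludes cycles.\<close>

lemma spanning_tree_exists:
  assumes "finite W" "W \<noteq> {}" "connected_graph W ES"
    and edges: "\<And>e. e \<in> ES \<Longrightarrow> \<exists>x y. e = {x, y} \<and> x \<noteq> y"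
  obtains TE where "TE \<subseteq> ES" "is_tree W TE"
proof -
  define F where "F = {e \<in> ES. e \<subseteq> W}"
  have "finite F"
    using assms(1) by (auto simp: F_def intro: finite_subset[of _ "Pow W"])
  have "connected_graph W F"
    using assms(3) by (rule connected_graph_cong) (simp add: F_def)
  then have "F \<subseteq> F \<and> connected_graph W F" by simp
  from ex_has_least_nat[where P = "\<lambda>TE. TE \<subseteq> F \<and> connected_graph W TE" and m = card, OF this]
  obtain TE where TE: "TE \<subseteq> F" "connected_graph W TE"
    and least: "\<And>TE'. TE' \<subseteq> F \<Longrightarrow> connected_graph W TE' \<Longrightarrow> card TE \<le> card TE'"
    by metis
  have "finite TE"
    using TE(1) \<open>finite F\<close> by (rule finite_subset)
  have "\<not> connected_graph W (TE - {e})" if "e \<in> TE" for e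
  proof
    assume "connected_graph W (TE - {e})"
    then have "card TE \<le> card (TE - {e})"
      using TE(1) by (intro least) blast
    moreover have "card (TE - {e}) < card TE"
      using \<open>finite TE\<close> that by (rule card_Diff1_less)
    ultimately show False by simp
  qed
  moreover have "\<exists>x y. e = {x, y} \<and> x \<noteq> y \<and> x \<in> W \<and> y \<in> W" if "e \<in> TE" for e
  proof -
    have "e \<in> ES" "e \<subseteq> W"
      using that TE(1) by (auto simp: F_def)
    then obtain x y where "e = {x, y}" "x \<noteq> y"
      using edges by blast
    then show ?thesis
      using \<open>e \<subseteq> W\<close> by blast
  qed
  ultimately have "is_tree W TE"
    unfolding is_tree_def using TE(2) assms(1,2) by (intro conjI ballI)
  moreover have "TE \<subseteq> ES"
    using TE(1) by (auto simp: F_def)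
  ultimately show thesis
    using that by blast
qed

definition mono_adjacent :: "'a set set \<Rightarrow> ('a \<Rightarrow> bool) \<Rightarrow> 'a set \<Rightarrow> 'a set \<Rightarrow> bool" where
  "mono_adjacent E c A B \<longleftrightarrow> (\<exists>x\<in>A. \<exists>y\<in>B. {x, y} \<in> E \<and> c x = c y)"

lemma mono_adjacent_sym: "mono_adjacent E c A B \<Longrightarrow> mono_adjacent E c B A"
  unfolding mono_adjacent_def by (metis insert_commute)

text \<open>Spanning trees made of bichromatic edges are properly coloured by \<open>c\<close>, and
  monochromatic adjacency supplies the joining edges, so \<open>c\<close> itself witnesses
  oddness.\<close>

lemma odd_Kt_minorI:
  assumes "finite V" "card I = t" "finite I"
    and P: "\<And>i. i \<in> I \<Longrightarrow> P i \<subseteq> V" "\<And>i. i \<in> I \<Longrightarrow> P i \<noteq> {}"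
      "\<And>i. i \<in> I \<Longrightarrow> connected_graph (P i) (cut_edges E c)"
    and disj: "\<And>i j. i \<in> I \<Longrightarrow> j \<in> I \<Longrightarrow> i \<noteq> j \<Longrightarrow> P i \<inter> P j = {}"
    and adj: "\<And>i j. i \<in> I \<Longrightarrow> j \<in> I \<Longrightarrow> i \<noteq> j \<Longrightarrow> mono_adjacent E c (P i) (P j)"
  shows "odd_Kt_minor V E t"
proof -
  obtain f where f: "bij_betw f {0..<t} I"
    using ex_bij_betw_nat_finite[OF assms(3)] unfolding assms(2) ..
  have fI: "f s \<in> I" if "s < t" for s
    using bij_betwE[OF f] that by simp
  have f_inj: "f s \<noteq> f s'" if "s < t" "s' < t" "s \<noteq> s'" for s s'
    using inj_on_eq_iff[OF bij_betw_imp_inj_on[OF f]] that by simp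
  have "\<exists>TE. TE \<subseteq> cut_edges E c \<and> is_tree (P (f s)) TE" if s: "s < t" for s
  proof -
    have "finite (P (f s))"
      using P(1)[OF fI[OF that]] assms(1) finite_subset by blast
    moreover have "\<exists>x y. e = {x, y} \<and> x \<noteq> y" if "e \<in> cut_edges E c" for e
    proof -
      have "\<exists>x y. e = {x, y} \<and> c x \<noteq> c y"
        using that by (simp add: cut_edges_def)
      then obtain x y where "e = {x, y}" "c x \<noteq> c y" by blast
      then show ?thesis
        by (intro exI[of _ x] exI[of _ y]) auto
    qed
    ultimately obtain TE where "TE \<subseteq> cut_edges E c" "is_tree (P (f s)) TE"
      by (rule spanning_tree_exists[OF _ P(2)[OF fI[OF s]] P(3)[OF fI[OF s]]])
    then show ?thesis by blast
  qed
  then have "\<forall>s. \<exists>TE. s < t \<longrightarrow> TE \<subseteq> cut_edges E c \<and> is_tree (P (f s)) TE"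
    by blast
  from choice[OF this] obtain TE where TE: "\<And>s. s < t \<Longrightarrow> TE s \<subseteq> cut_edges E c"
      "\<And>s. s < t \<Longrightarrow> is_tree (P (f s)) (TE s)"
    by blast
  have "\<forall>s s'. \<exists>x y. s < t \<and> s' < t \<and> s \<noteq> s' \<longrightarrow>
      x \<in> P (f s) \<and> y \<in> P (f s') \<and> {x, y} \<in> E \<and> c x = c y"
    using adj[OF fI fI f_inj] unfolding mono_adjacent_def by blast
  then obtain a b where ab': "\<forall>s s'. s < t \<and> s' < t \<and> s \<noteq> s' \<longrightarrow>
      a s s' \<in> P (f s) \<and> b s s' \<in> P (f s') \<and> {a s s', b s s'} \<in> E \<and> c (a s s') = c (b s s')"
    by metis
  have ab: "a s s' \<in> P (f s)" "b s s' \<in> P (f s')" "{a s s', b s s'} \<in> E"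
      "c (a s s') = c (b s s')" if "s < t" "s' < t" "s \<noteq> s'" for s s'
    using ab' that by blast+
  \<comment> \<open>The edges chosen for \<open>(s, s')\<close> and \<open>(s', s)\<close> may
    differ. Sorting the indices selects one of them and makes \<open>X\<close> symmetric.\<close>
  define X where "X s s' = {a (min s s') (max s s'), b (min s s') (max s s')}" for s s'
  have X: "X s s' = X s' s \<and> X s s' \<in> E \<and> (\<exists>x y. X s s' = {x, y} \<and> x \<in> P (f s) \<and> y \<in> P (f s'))"
    "\<forall>x\<in>X s s'. \<forall>y\<in>X s s'. c x = c y"
    if "s < t" "s' < t" "s \<noteq> s'" for s s'
  proof -
    have sym: "X s s' = X s' s"
      by (simp add: X_def min.commute max.commute)
    have "s < s' \<or> s' < s"
      using that by linarith
    then have "X s s' = {a s s', b s s'} \<or> X s s' = {b s' s, a s' s}"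
      by (auto simp: X_def)
    then show "X s s' = X s' s \<and> X s s' \<in> E \<and> (\<exists>x y. X s s' = {x, y} \<and> x \<in> P (f s) \<and> y \<in> P (f s'))"
    proof
      assume eq: "X s s' = {a s s', b s s'}"
      then have "X s s' \<in> E"
        using ab(3)[OF that] by simp
      moreover have "\<exists>x y. X s s' = {x, y} \<and> x \<in> P (f s) \<and> y \<in> P (f s')"
        using ab(1,2)[OF that] eq by (intro exI[of _ "a s s'"] exI[of _ "b s s'"]) simp
      ultimately show ?thesis
        using sym by (intro conjI)
    next
      assume eq: "X s s' = {b s' s, a s' s}"
      then have "X s s' \<in> E"
        using ab(3)[of s' s] that by (simp add: insert_commute)
      moreover have "\<exists>x y. X s s' = {x, y} \<and> x \<in> P (f s) \<and> y \<in> P (f s')"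
        using ab(1,2)[of s' s] that eq by (intro exI[of _ "b s' s"] exI[of _ "a s' s"]) simp
      ultimately show ?thesis
        using sym by (intro conjI)
    qed
    have "c (a (min s s') (max s s')) = c (b (min s s') (max s s'))"
      using that by (intro ab(4)) auto
    then show "\<forall>x\<in>X s s'. \<forall>y\<in>X s s'. c x = c y"
      by (simp add: X_def)
  qed
  show ?thesis
    unfolding odd_Kt_minor_def
  proof (rule exI[of _ "\<lambda>s. P (f s)"], rule exI[of _ TE], rule exI[of _ X], rule exI[of _ c],
      intro conjI allI impI)
    fix s assume s: "s < t"
    show "P (f s) \<subseteq> V" "is_tree (P (f s)) (TE s)"
      using P(1)[OF fI[OF s]] TE(2)[OF s] .
    show "TE s \<subseteq> E"
      using TE(1)[OF s] by (auto simp: cut_edges_def)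
    show "c x \<noteq> c y" if "{x, y} \<in> TE s" for x y
    proof -
      have "{x, y} \<in> cut_edges E c"
        using TE(1)[OF s] that by blast
      then show ?thesis by simp
    qed
  next
    fix s s' assume s: "s < t" "s' < t" "s \<noteq> s'"
    show "P (f s) \<inter> P (f s') = {}"
      using s by (intro disj fI f_inj)
    show "X s s' = X s' s" "X s s' \<in> E" "\<exists>x y. X s s' = {x, y} \<and> x \<in> P (f s) \<and> y \<in> P (f s')"
      by (rule X(1)[OF s, THEN conjunct1] X(1)[OF s, THEN conjunct2, THEN conjunct1]
          X(1)[OF s, THEN conjunct2, THEN conjunct2])+
    show "\<forall>x\<in>X s s'. \<forall>y\<in>X s s'. c x = c y"
      by (rule X(2)[OF s])
  qed
qed

section \<open>Partial colourings\<close>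

definition touches :: "'a set set \<Rightarrow> 'a set \<Rightarrow> 'a set \<Rightarrow> bool" where
  "touches E A B \<longleftrightarrow> (\<exists>x\<in>A. \<exists>y\<in>B. {x, y} \<in> E)"

definition part :: "'a set \<Rightarrow> ('a \<Rightarrow> 'b) \<Rightarrow> 'b \<Rightarrow> 'a set" where
  "part U p i = {x \<in> U. p x = i}"

text \<open>A vertex \<open>x\<close> of \<open>U\<close> lies in the part labelled \<open>p x\<close>, and its final colour is the pair of
  \<open>q (p x)\<close> and \<open>c x\<close>.\<close>

locale partial_colouring =
  fixes V :: "'a set" and E :: "'a set set" and n m :: nat
    and U :: "'a set" and p :: "'a \<Rightarrow> nat" and c :: "'a \<Rightarrow> bool" and q :: "nat \<Rightarrow> nat"
  assumes U_subset: "U \<subseteq> V"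
    and connected_part: "connected_graph (part U p i) (cut_edges E c)"
    and card_mono_connected: "X \<subseteq> part U p i \<Longrightarrow> mono_connected E c X \<Longrightarrow> card X \<le> m"
    and q_proper: "i \<noteq> j \<Longrightarrow> mono_adjacent E c (part U p i) (part U p j) \<Longrightarrow> q i \<noteq> q j"
    and q_less: "q i < n"
    and mono_adjacent_if_touches: "i \<noteq> j \<Longrightarrow> Z \<subseteq> V - U \<Longrightarrow> connected_graph Z E \<Longrightarrow>
      touches E Z (part U p i) \<Longrightarrow> touches E Z (part U p j) \<Longrightarrow>
      mono_adjacent E c (part U p i) (part U p j)"

section \<open>Extending a partial colouring by one vertex or by one part\<close>

lemma mono_adjacent_mono:
  assumes "mono_adjacent E c A B" "A \<subseteq> A'" "B \<subseteq> B'" "\<And>x. x \<in> A \<union> B \<Longrightarrow> d x = c x"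
  shows "mono_adjacent E d A' B'"
proof -
  obtain x y where "x \<in> A" "y \<in> B" "{x, y} \<in> E" "c x = c y"
    using assms(1) unfolding mono_adjacent_def by blast
  then have "x \<in> A'" "y \<in> B'" "{x, y} \<in> E" "d x = d y"
    using assms(2-4) by auto
  then show ?thesis
    unfolding mono_adjacent_def by blast
qed

text \<open>The new vertex gets the colour opposite to all its neighbours in part \<open>i\<close>,
  so it is joined to the part by a bichromatic edge and is alone in its monochromatic connected sets
  there. The labels \<open>q\<close> can stay, because no pair of parts becomes newly
  adjacent.\<close>

lemma (in partial_colouring) absorb:
  assumes "1 \<le> m"
    and x: "x \<in> V - U" "touches E {x} (part U p i)"
    and one: "\<And>y. y \<in> part U p i \<Longrightarrow> {x, y} \<in> E \<Longrightarrow> c y = a"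
  shows "partial_colouring V E n m (insert x U) (p(x := i)) (c(x := (\<not> a))) q"
proof -
  define p' where "p' = p(x := i)"
  define d where "d = c(x := (\<not> a))"
  have d: "d y = c y" if "y \<in> U" for y
    using that x(1) by (auto simp: d_def)
  have part_i: "part (insert x U) p' i = insert x (part U p i)"
    using x(1) by (auto simp: part_def p'_def)
  have part_other: "part (insert x U) p' j = part U p j" if "j \<noteq> i" for j
    using x(1) that by (auto simp: part_def p'_def)
  have part_U: "part U p j \<subseteq> U" for j
    by (auto simp: part_def)
  have sub: "part U p j \<subseteq> part (insert x U) p' j" for j
    using part_i part_other by (cases "j = i") auto
  have dp: "d y = c y" if "y \<in> part U p j" for y j
    using d part_U that by blast
  have conn_d: "connected_graph (part U p j) (cut_edges E d)" for j
  proof (rule connected_graph_cong)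
    show "connected_graph (part U p j) (cut_edges E c)"
      by (rule connected_part)
  qed (simp add: dp)
  obtain y where y: "y \<in> part U p i" "{x, y} \<in> E"
    using x(2) unfolding touches_def by blast
  then have "connected_graph (insert x (part U p i)) (cut_edges E d)"
    using one[OF y] dp[OF y(1)]
    by (intro connected_graph_insert[OF conn_d, of y]) (simp_all add: insert_commute d_def)
  then have conn: "connected_graph (part (insert x U) p' j) (cut_edges E d)" for j
    using conn_d part_i part_other by (cases "j = i") simp_all
  have card_old: "card X \<le> m" if "X \<subseteq> part U p j" "mono_connected E d X" for X j
  proof (rule card_mono_connected[OF that(1)])
    show "mono_connected E c X"
      using that dp by (intro mono_connected_cong[OF that(2)]) blast
  qed
  have card: "card X \<le> m" if X: "X \<subseteq> part (insert x U) p' j" "mono_connected E d X" for X j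
  proof (cases "x \<in> X")
    case False
    then have "X \<subseteq> part U p j"
      using X(1) part_i part_other[of j] by (cases "j = i") auto
    then show ?thesis
      using X(2) by (rule card_old)
  next
    case True
    have "j = i"
    proof (rule ccontr)
      assume "j \<noteq> i"
      then show False
        using True X(1) part_other part_U[of j] x(1) by blast
    qed
    then have Xi: "X - {x} \<subseteq> part U p i"
      using X(1) part_i by blast
    have "X = {x}"
    proof (rule ccontr)
      assume "X \<noteq> {x}"
      then have "{x} \<subseteq> X" "{x} \<noteq> {}" "{x} \<noteq> X"
        using True by blast+
      then obtain u w where "u \<in> {x}" "w \<in> X - {x}" "{u, w} \<in> E"
        using connected_graph_cut[of X E "{x}"] X(2) unfolding mono_connected_def by metis
      then have w: "w \<in> X" "w \<in> part U p i" "{x, w} \<in> E"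
        using Xi by auto
      then have "d w = a" "d x = (\<not> a)"
        using dp[OF w(2)] one[OF w(2,3)] by (simp_all add: d_def)
      moreover have "d w = d x"
        using X(2) w(1) True unfolding mono_connected_def by fast
      ultimately show False by simp
    qed
    then show ?thesis
      using \<open>1 \<le> m\<close> by simp
  qed
  have colour_i: "q i \<noteq> q j"
    if ji: "j \<noteq> i" and adj: "mono_adjacent E d (part (insert x U) p' i) (part (insert x U) p' j)" for j
  proof -
    obtain u w where uw: "u \<in> insert x (part U p i)" "w \<in> part U p j" "{u, w} \<in> E" "d u = d w"
      using adj unfolding part_i part_other[OF ji] mono_adjacent_def by blast
    have "mono_adjacent E c (part U p i) (part U p j)"
    \<comment> \<open>For an edge at \<open>x\<close>, the set \<open>{x}\<close> was connected,
      uncovered and touching both parts, so the invariant had already made them adjacent.\<close>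
    proof (cases "u = x")
      case True
      then have "touches E {x} (part U p j)"
        using uw unfolding touches_def by blast
      then show ?thesis
        using ji x by (intro mono_adjacent_if_touches[of i j "{x}"] connected_graph_singleton) auto
    next
      case False
      then have "u \<in> part U p i"
        using uw(1) by blast
      then have "c u = c w"
        using uw(2,4) dp[of u] dp[of w] by simp
      then show ?thesis
        using uw \<open>u \<in> part U p i\<close> unfolding mono_adjacent_def by blast
    qed
    then show ?thesis
      using ji by (intro q_proper) simp_all
  qed
  have colour: "q j \<noteq> q k"
    if "j \<noteq> k" and adj: "mono_adjacent E d (part (insert x U) p' j) (part (insert x U) p' k)" for j k
  proof -
    consider "j = i" | "k = i" | "j \<noteq> i" "k \<noteq> i" by blast
    then show ?thesis
    proof cases
      case 1
      then show ?thesis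
        using colour_i[of k] \<open>j \<noteq> k\<close> adj by simp
    next
      case 2
      then show ?thesis
        using colour_i[of j] \<open>j \<noteq> k\<close> mono_adjacent_sym[OF adj] by auto
    next
      case 3
      then have "mono_adjacent E d (part U p j) (part U p k)"
        using adj part_other by simp
      then have "mono_adjacent E c (part U p j) (part U p k)"
        by (rule mono_adjacent_mono) (auto simp: dp)
      then show ?thesis
        using \<open>j \<noteq> k\<close> by (intro q_proper)
    qed
  qed
  have clique: "mono_adjacent E d (part (insert x U) p' j) (part (insert x U) p' k)"
    if "j \<noteq> k" and Z: "Z \<subseteq> V - insert x U" "connected_graph Z E"
      and t: "touches E Z (part (insert x U) p' j)" "touches E Z (part (insert x U) p' k)" for j k Z
  proof -
    \<comment> \<open>If \<open>Z\<close> has an edge to \<open>x\<close>, then \<open>Z'\<close> is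
      \<open>insert x Z\<close>, which touches part \<open>i\<close> through \<open>x\<close>;
      otherwise \<open>Z\<close> itself works.\<close>
    have "\<exists>Z'. Z' \<subseteq> V - U \<and> connected_graph Z' E \<and>
        (\<forall>l. touches E Z (part (insert x U) p' l) \<longrightarrow> touches E Z' (part U p l))"
    proof (cases "\<exists>z\<in>Z. {z, x} \<in> E")
      case True
      then obtain z where z: "z \<in> Z" "{z, x} \<in> E" by blast
      have "touches E (insert x Z) (part U p l)" if "touches E Z (part (insert x U) p' l)" for l
      proof (cases "l = i")
        case True
        then show ?thesis
          using x(2) unfolding touches_def by blast
      next
        case False
        then show ?thesis
          using that unfolding touches_def part_other[OF False] by blast
      qed
      moreover have "connected_graph (insert x Z) E"
        by (rule connected_graph_insert[OF Z(2) z])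
      moreover have "insert x Z \<subseteq> V - U"
        using Z(1) x(1) by blast
      ultimately show ?thesis by blast
    next
      case False
      have "touches E Z (part U p l)" if l: "touches E Z (part (insert x U) p' l)" for l
      proof -
        obtain z y where zy: "z \<in> Z" "y \<in> part (insert x U) p' l" "{z, y} \<in> E"
          using l unfolding touches_def by blast
        then have "y \<noteq> x"
          using False by blast
        then have "y \<in> part U p l"
          using zy(2) part_i part_other[of l] by (cases "l = i") auto
        then show ?thesis
          using zy unfolding touches_def by blast
      qed
      moreover have "Z \<subseteq> V - U"
        using Z(1) by blast
      ultimately show ?thesis
        using Z(2) by blast
    qed
    then obtain Z' where "Z' \<subseteq> V - U" "connected_graph Z' E"
      "touches E Z' (part U p j)" "touches E Z' (part U p k)"
      using t by blast
    then have "mono_adjacent E c (part U p j) (part U p k)"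
      by (rule mono_adjacent_if_touches[OF \<open>j \<noteq> k\<close>])
    then show ?thesis
      by (rule mono_adjacent_mono[OF _ sub sub]) (auto simp: dp)
  qed
  show ?thesis
    unfolding p'_def[symmetric] d_def[symmetric]
  proof
    show "insert x U \<subseteq> V"
      using U_subset x(1) by blast
  qed (fact conn card colour q_less clique)+
qed

text \<open>Since \<open>C\<close> is closed in the uncovered graph, a connected uncovered set that
  touches \<open>W\<close> lies in \<open>C\<close>. Every old part it touches therefore touches
  \<open>C\<close> and is adjacent to \<open>W\<close> by assumption. For the same reason
  \<open>a\<close> only has to avoid the labels of parts touching \<open>C\<close>.\<close>

lemma (in partial_colouring) add_part:
  assumes fresh: "k \<notin> p ` U"
    and C: "C \<subseteq> V - U" "\<And>x y. x \<in> C \<Longrightarrow> y \<in> V - U \<Longrightarrow> {x, y} \<in> E \<Longrightarrow> y \<in> C"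
    and W: "W \<subseteq> C" "connected_graph W (cut_edges E d)"
      "\<And>X. X \<subseteq> W \<Longrightarrow> mono_connected E d X \<Longrightarrow> card X \<le> m"
    and nbr: "\<And>i. touches E C (part U p i) \<Longrightarrow>
      mono_adjacent E (\<lambda>x. if x \<in> U then c x else d x) W (part U p i)"
    and a: "a < n" "\<And>i. touches E C (part U p i) \<Longrightarrow> q i \<noteq> a"
  shows "partial_colouring V E n m (U \<union> W) (\<lambda>x. if x \<in> U then p x else k)
    (\<lambda>x. if x \<in> U then c x else d x) (q(k := a))"
proof -
  define p' where "p' = (\<lambda>x. if x \<in> U then p x else k)"
  define e where "e = (\<lambda>x. if x \<in> U then c x else d x)"
  define q' where "q' = q(k := a)"
  have WU: "W \<inter> U = {}"
    using W(1) C(1) by blast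
  have part_k: "part (U \<union> W) p' k = W"
    using fresh WU by (auto simp: part_def p'_def)
  have part_other: "part (U \<union> W) p' i = part U p i" if "i \<noteq> k" for i
    using that WU by (auto simp: part_def p'_def)
  have ec: "e x = c x" if "x \<in> part U p i" for x i
    using that by (simp add: e_def part_def)
  have ed: "e x = d x" if "x \<in> W" for x
  proof -
    have "x \<notin> U"
      using that WU by blast
    then show ?thesis by (simp add: e_def)
  qed
  have conn_c: "connected_graph (part U p i) (cut_edges E e)" for i
    by (rule connected_graph_cong[OF connected_part]) (simp add: ec)
  have "connected_graph W (cut_edges E e)"
    by (rule connected_graph_cong[OF W(2)]) (simp add: ed)
  then have conn: "connected_graph (part (U \<union> W) p' i) (cut_edges E e)" for i
    using conn_c part_k part_other by (cases "i = k") simp_all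
  have card: "card X \<le> m" if X: "X \<subseteq> part (U \<union> W) p' i" "mono_connected E e X" for X i
  proof (cases "i = k")
    case True
    then have XW: "X \<subseteq> W"
      using X(1) part_k by simp
    moreover have "mono_connected E d X"
      using XW by (intro mono_connected_cong[OF X(2)] ed) blast
    ultimately show ?thesis
      by (rule W(3))
  next
    case False
    then have Xi: "X \<subseteq> part U p i"
      using X(1) part_other by simp
    moreover have "mono_connected E c X"
      using Xi by (intro mono_connected_cong[OF X(2)] ec) blast
    ultimately show ?thesis
      by (rule card_mono_connected)
  qed
  have proper_k: "q i \<noteq> a" if "mono_adjacent E e W (part U p i)" for i
  proof (rule a(2))
    show "touches E C (part U p i)"
      using that W(1) unfolding mono_adjacent_def touches_def by blast
  qed
  have proper: "q' i \<noteq> q' j"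
    if ij: "i \<noteq> j" and adj: "mono_adjacent E e (part (U \<union> W) p' i) (part (U \<union> W) p' j)" for i j
  proof -
    consider "i = k" "j \<noteq> k" | "i \<noteq> k" "j = k" | "i \<noteq> k" "j \<noteq> k"
      using ij by blast
    then show ?thesis
    proof cases
      case 1
      then have "mono_adjacent E e W (part U p j)"
        using adj part_k part_other[of j] by simp
      from proper_k[OF this] show ?thesis
        using 1 by (simp add: q'_def)
    next
      case 2
      then have "mono_adjacent E e W (part U p i)"
        using mono_adjacent_sym[OF adj] part_k part_other[of i] by simp
      from proper_k[OF this] show ?thesis
        using 2 by (simp add: q'_def)
    next
      case 3
      then have "mono_adjacent E e (part U p i) (part U p j)"
        using adj part_other by simp
      then have "mono_adjacent E c (part U p i) (part U p j)"
        by (rule mono_adjacent_mono) (auto simp: ec)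
      from q_proper[OF ij this] show ?thesis
        using 3 by (simp add: q'_def)
    qed
  qed
  have clique_k: "mono_adjacent E e W (part U p i)"
    if Z: "Z \<subseteq> V - U" "connected_graph Z E" "touches E Z W" "touches E Z (part U p i)" for Z i
  proof -
    obtain z w where zw: "z \<in> Z" "w \<in> W" "{z, w} \<in> E"
      using Z(3) unfolding touches_def by blast
    have "z \<in> C"
      using C(2)[of w z] zw Z(1) W(1) by (auto simp: insert_commute)
    have "Z \<subseteq> C"
    proof
      fix y assume "y \<in> Z"
      then have "reach Z E z y"
        using Z(2) zw(1) by (simp add: connected_graph_def)
      then show "y \<in> C"
        using \<open>z \<in> C\<close>
      proof (rule reach_closed)
        fix x y assume "x \<in> C" "y \<in> Z" "{x, y} \<in> E"
        then show "y \<in> C"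
          using C(2) Z(1) by blast
      qed
    qed
    then have "touches E C (part U p i)"
      using Z(4) unfolding touches_def by blast
    then show ?thesis
      unfolding e_def by (rule nbr)
  qed
  have clique: "mono_adjacent E e (part (U \<union> W) p' i) (part (U \<union> W) p' j)"
    if ij: "i \<noteq> j" and Z: "Z \<subseteq> V - (U \<union> W)" "connected_graph Z E"
      and t: "touches E Z (part (U \<union> W) p' i)" "touches E Z (part (U \<union> W) p' j)" for i j Z
  proof -
    have ZU: "Z \<subseteq> V - U"
      using Z(1) by blast
    consider "i = k" "j \<noteq> k" | "i \<noteq> k" "j = k" | "i \<noteq> k" "j \<noteq> k"
      using ij by blast
    then show ?thesis
    proof cases
      case 1
      then show ?thesis
        using clique_k[OF ZU Z(2)] t part_k part_other[of j] by simp
    next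
      case 2
      have "mono_adjacent E e W (part U p i)"
        using 2 clique_k[OF ZU Z(2)] t part_k part_other[of i] by simp
      from mono_adjacent_sym[OF this] show ?thesis
        using 2 part_k part_other[of i] by simp
    next
      case 3
      have "mono_adjacent E c (part U p i) (part U p j)"
        using 3 t part_other by (intro mono_adjacent_if_touches[OF ij ZU Z(2)]) simp_all
      then have "mono_adjacent E e (part U p i) (part U p j)"
        by (rule mono_adjacent_mono) (auto simp: ec)
      then show ?thesis
        using 3 part_other by simp
    qed
  qed
  show ?thesis
    unfolding p'_def[symmetric] e_def[symmetric] q'_def[symmetric]
  proof
    show "U \<union> W \<subseteq> V"
      using U_subset C(1) W(1) by blast
    show "q' i < n" for i
      using q_less a(1) by (simp add: q'_def)
  qed (fact conn card proper clique)+
qed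

text \<open>Either some uncovered vertex sees just one colour of a part and is absorbed, or a new
  part is built in an uncovered component; excluding the odd minor limits how many old parts that
  component touches.\<close>

lemma (in partial_colouring) extend:
  assumes "finite V" "3 \<le> t" and nm: "n = t - 1" "m = (t - 1) div 2"
    and no_minor: "\<not> odd_Kt_minor V E t" and "U \<noteq> V"
  shows "\<exists>U' p' c' q'. partial_colouring V E n m U' p' c' q' \<and> U \<subset> U'"
proof (cases "\<exists>x i a. x \<in> V - U \<and> touches E {x} (part U p i) \<and>
    (\<forall>y\<in>part U p i. {x, y} \<in> E \<longrightarrow> c y = a)")
  case True
  then obtain x i a where x: "x \<in> V - U" "touches E {x} (part U p i)"
    and one: "\<forall>y\<in>part U p i. {x, y} \<in> E \<longrightarrow> c y = a"
    by (elim exE conjE)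
  \<comment> \<open>An absorbed vertex forms a monochromatic connected set of size 1, so
    \<open>m\<close> must be positive; this comes from \<open>3 \<le> t\<close>.\<close>
  have "1 \<le> m"
    using assms(2) nm by simp
  then have "partial_colouring V E n m (insert x U) (p(x := i)) (c(x := (\<not> a))) q"
    by (rule absorb[OF _ x]) (use one in simp)
  moreover have "U \<subset> insert x U"
    using x(1) by blast
  ultimately show ?thesis
    by (intro exI conjI)
next
  case False
  have both: "\<exists>y\<in>part U p i. {x, y} \<in> E \<and> c y \<noteq> a"
    if "x \<in> V - U" "touches E {x} (part U p i)" for x i a
  proof (rule ccontr)
    assume "\<not> ?thesis"
    then have "\<forall>y\<in>part U p i. {x, y} \<in> E \<longrightarrow> c y = a" by simp
    with that have "\<exists>x i a. x \<in> V - U \<and> touches E {x} (part U p i) \<and>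
        (\<forall>y\<in>part U p i. {x, y} \<in> E \<longrightarrow> c y = a)"
      by (intro exI conjI)
    with False show False by (rule notE)
  qed
  obtain v where v: "v \<in> V - U"
    using \<open>U \<noteq> V\<close> U_subset by blast
  define C where "C = {u. reach (V - U) E v u}"
  have C_sub: "C \<subseteq> V - U"
    using reach_in unfolding C_def by fast
  have C_conn: "connected_graph C E"
    unfolding C_def by (rule connected_graph_component)
  have C_closed: "y \<in> C" if "x \<in> C" "y \<in> V - U" "{x, y} \<in> E" for x y
    using that reach_edge[of "V - U" E v x y] by (simp add: C_def)
  define N where "N = {i. touches E C (part U p i)}"
  have "N \<subseteq> p ` U"
    unfolding N_def touches_def part_def by blast
  moreover have "finite U"
    using U_subset assms(1) by (rule finite_subset)
  ultimately have "finite N"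
    using finite_subset by blast
  have "\<forall>i. \<exists>x. i \<in> N \<longrightarrow> x \<in> C \<and> touches E {x} (part U p i)"
    unfolding N_def touches_def by blast
  from choice[OF this] obtain z where z: "\<And>i. i \<in> N \<Longrightarrow> z i \<in> C"
      "\<And>i. i \<in> N \<Longrightarrow> touches E {z i} (part U p i)"
    by blast
  \<comment> \<open>One contact vertex per neighbouring part. The default \<open>{v}\<close> keeps
    \<open>S\<close> nonempty when no part touches \<open>C\<close>.\<close>
  define S where "S = (if N = {} then {v} else z ` N)"
  have "v \<in> C"
    using reach_refl[OF v] by (simp add: C_def)
  then have "S \<subseteq> C" "S \<noteq> {}"
    using z(1) by (auto simp: S_def)
  have "finite C"
    using C_sub finite_Diff[OF assms(1)] by (rule finite_subset)
  obtain W d where W: "S \<subseteq> W" "W \<subseteq> C" "connected_graph W (cut_edges E d)"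
    and W_card: "\<And>X. X \<subseteq> W \<Longrightarrow> mono_connected E d X \<Longrightarrow> card X \<le> (card S + 1) div 2"
    by (rule clustered_hull[OF \<open>finite C\<close> C_conn \<open>S \<subseteq> C\<close> \<open>S \<noteq> {}\<close>]) (rule that)
  define e where "e = (\<lambda>x. if x \<in> U then c x else d x)"
  have ec: "e x = c x" if "x \<in> part U p i" for x i
    using that by (simp add: e_def part_def)
  have WU: "W \<inter> U = {}"
    using W(2) C_sub by blast
  have ed: "e x = d x" if "x \<in> W" for x
  proof -
    have "x \<notin> U"
      using that WU by blast
    then show ?thesis by (simp add: e_def)
  qed
  have nbr: "mono_adjacent E e W (part U p i)" if iN: "i \<in> N" for i
  proof -
    have "z i \<in> W"
      using W(1) iN by (auto simp: S_def split: if_splits)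
    have zi: "z i \<in> V - U"
      using z(1)[OF iN] C_sub by blast
    \<comment> \<open>Excluding the colour \<open>\<not> d (z i)\<close> yields a neighbour with the
      same colour as \<open>z i\<close>.\<close>
    obtain y where y: "y \<in> part U p i" "{z i, y} \<in> E" "c y \<noteq> (\<not> d (z i))"
      using both[OF zi z(2)[OF iN], of "\<not> d (z i)"] by (elim bexE conjE)
    then have "e (z i) = e y"
      using ec[OF y(1)] ed[OF \<open>z i \<in> W\<close>] by simp
    then show ?thesis
      using y \<open>z i \<in> W\<close> unfolding mono_adjacent_def by blast
  qed
  obtain k where k: "k \<notin> p ` U"
    using ex_new_if_finite[of "p ` U"] \<open>finite U\<close> by auto
  \<comment> \<open>Otherwise \<open>t - 1\<close> parts touching \<open>C\<close>, which are
    pairwise adjacent by the invariant, form an odd \<open>K_t\<close> minor together with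
    \<open>W\<close>.\<close>
  have "card N \<le> t - 2"
  proof (rule ccontr)
    assume "\<not> card N \<le> t - 2"
    then have "t - 1 \<le> card N" by linarith
    then obtain N' where N': "N' \<subseteq> N" "card N' = t - 1" "finite N'"
      by (rule obtain_subset_with_card_n)
    have kN': "k \<notin> N'"
      using N'(1) \<open>N \<subseteq> p ` U\<close> k by blast
    define P where "P i = (if i = k then W else part U p i)" for i
    have P_k: "P k = W"
      by (simp add: P_def)
    have P_N': "P i = part U p i" "i \<in> N" if "i \<in> N'" for i
      using that kN' N'(1) by (auto simp: P_def)
    have adj_k: "mono_adjacent E e (P k) (P i)" if "i \<in> N'" for i
      using nbr P_N'[OF that] by (simp add: P_k)
    have part_U: "part U p i \<subseteq> U" for i
      by (auto simp: part_def)
    have "odd_Kt_minor V E t"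
    proof (rule odd_Kt_minorI[of V "insert k N'" t P E e])
      show "card (insert k N') = t"
        using N' kN' assms(2) by simp
      show "P i \<subseteq> V" if "i \<in> insert k N'" for i
        using that part_U U_subset W(2) C_sub unfolding P_def by (auto split: if_splits)
      show "P i \<noteq> {}" if "i \<in> insert k N'" for i
      proof (cases "i = k")
        case True
        then show ?thesis
          using P_k W(1) \<open>S \<noteq> {}\<close> by auto
      next
        case False
        then have "mono_adjacent E e W (P i)"
          using that adj_k P_k by simp
        then show ?thesis
          unfolding mono_adjacent_def by blast
      qed
      show "connected_graph (P i) (cut_edges E e)" for i
      proof (cases "i = k")
        case True
        have "connected_graph W (cut_edges E e)"
          by (rule connected_graph_cong[OF W(3)]) (simp add: ed)
        then show ?thesis
          using True P_k by simp
      next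
        case False
        have "connected_graph (part U p i) (cut_edges E e)"
          by (rule connected_graph_cong[OF connected_part]) (simp add: ec)
        then show ?thesis
          using False by (simp add: P_def)
      qed
      show "P i \<inter> P j = {}" if "i \<noteq> j" for i j
        using that WU by (auto simp: P_def part_def)
      show "mono_adjacent E e (P i) (P j)"
        if ij: "i \<in> insert k N'" "j \<in> insert k N'" "i \<noteq> j" for i j
      proof -
        consider "i = k" "j \<in> N'" | "i \<in> N'" "j = k" | "i \<in> N'" "j \<in> N'"
          using ij by blast
        then show ?thesis
        proof cases
          case 1
          then show ?thesis
            using adj_k by simp
        next
          case 2
          then show ?thesis
            using mono_adjacent_sym[OF adj_k] by simp
        next
          case 3
          have "touches E C (part U p i)" "touches E C (part U p j)"
            using P_N'(2) 3 by (simp_all add: N_def)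
          then have "mono_adjacent E c (part U p i) (part U p j)"
            by (rule mono_adjacent_if_touches[OF ij(3) C_sub C_conn])
          then have "mono_adjacent E e (part U p i) (part U p j)"
            by (rule mono_adjacent_mono) (auto simp: ec)
          then show ?thesis
            using P_N'(1) 3 by simp
        qed
      qed
    qed (use assms(1) N'(3) in simp_all)
    then show False
      using no_minor by simp
  qed
  have "card S \<le> t - 2"
  proof (cases "N = {}")
    case True
    then show ?thesis
      using assms(2) by (simp add: S_def)
  next
    case False
    then have "card S \<le> card N"
      using card_image_le[OF \<open>finite N\<close>, of z] by (simp add: S_def)
    then show ?thesis
      using \<open>card N \<le> t - 2\<close> by linarith
  qed
  \<comment> \<open>The bound \<open>card S + 1 \<le> t - 1\<close> is halved; this is where the
    value of \<open>m\<close> originates.\<close>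
  then have S_bound: "(card S + 1) div 2 \<le> m"
    unfolding nm using assms(2) by (intro div_le_mono) linarith
  \<comment> \<open>At most \<open>t - 2\<close> of the \<open>n = t - 1\<close> labels are blocked,
    so one is free for the new part.\<close>
  have "card (q ` N) \<le> t - 2"
    using card_image_le[OF \<open>finite N\<close>, of q] \<open>card N \<le> t - 2\<close> by linarith
  then have "\<not> {..<n} \<subseteq> q ` N"
    using card_mono[of "q ` N" "{..<n}"] \<open>finite N\<close> assms(2) nm by auto
  then obtain a where a: "a < n" "a \<notin> q ` N" by blast
  have "partial_colouring V E n m (U \<union> W) (\<lambda>x. if x \<in> U then p x else k) e (q(k := a))"
    unfolding e_def
  proof (rule add_part[OF k C_sub C_closed W(2,3)])
    show "card X \<le> m" if "X \<subseteq> W" "mono_connected E d X" for X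
      using W_card[OF that] S_bound by linarith
    show "mono_adjacent E (\<lambda>x. if x \<in> U then c x else d x) W (part U p i)"
      if "touches E C (part U p i)" for i
      using nbr[of i] that by (simp add: N_def e_def)
    show "q i \<noteq> a" if "touches E C (part U p i)" for i
      using a(2) that by (auto simp: N_def)
  qed (use a in auto)
  moreover have "U \<subset> U \<union> W"
    using WU W(1) \<open>S \<noteq> {}\<close> by blast
  ultimately show ?thesis by blast
qed

section \<open>Covering the whole graph and reading off the final colouring\<close>

lemma partial_colouring_total:
  assumes "partial_colouring V E (t - 1) ((t - 1) div 2) U p c q"
    and "finite V" "3 \<le> t" "\<not> odd_Kt_minor V E t"
  shows "\<exists>p c q. partial_colouring V E (t - 1) ((t - 1) div 2) V p c q"
  using assms(1)
proof (induction "card (V - U)" arbitrary: U p c q rule: less_induct)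
  case less
  show ?case
  proof (cases "U = V")
    case True
    then show ?thesis
      using less.prems by blast
  next
    case False
    then obtain U' p' c' q' where U': "partial_colouring V E (t - 1) ((t - 1) div 2) U' p' c' q'" "U \<subset> U'"
      using partial_colouring.extend[OF less.prems assms(2,3) refl refl assms(4)] by blast
    moreover have "U' \<subseteq> V"
      using U'(1) by (rule partial_colouring.U_subset)
    ultimately have "card (V - U') < card (V - U)"
      using assms(2) by (intro psubset_card_mono) auto
    then show ?thesis
      using less.hyps U'(1) by blast
  qed
qed

lemma partial_colouring_empty:
  "0 < n \<Longrightarrow> partial_colouring V E n m {} (\<lambda>_. 0) (\<lambda>_. True) (\<lambda>_. 0)"
  by unfold_locales
    (auto simp: part_def connected_graph_empty mono_adjacent_def touches_def)

theorem theorem1: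
  fixes V :: "'a set" and E :: "'a set set" and t :: nat
  assumes "t \<ge> 3"
    and "simple_graph V E"
    and "\<not> odd_Kt_minor V E t"
  shows "\<exists>(S :: nat set) (c :: 'a \<Rightarrow> nat). card S = 2 * t - 2 \<and> c ` V \<subseteq> S \<and>
           (\<forall>C. mono_component V E c C \<longrightarrow> int (card C) \<le> ceiling ((real t - 2) / 2))"
proof -
  obtain p c q where pc: "partial_colouring V E (t - 1) ((t - 1) div 2) V p c q"
    using partial_colouring_total[OF partial_colouring_empty _ assms(1,3)] assms(1,2)
    by (auto simp: simple_graph_def)
  interpret partial_colouring V E "t - 1" "(t - 1) div 2" V p c q
    by (rule pc)
  \<comment> \<open>Encodes the pair of \<open>q (p x) < t - 1\<close> and the Boolean
    \<open>c x\<close> as a number below \<open>2 * t - 2\<close>.\<close>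
  define f where "f x = 2 * q (p x) + (if c x then 1 else 0)" for x
  have f_eq: "q (p x) = q (p y) \<and> c x = c y" if "f x = f y" for x y
    using that unfolding f_def by (cases "c x"; cases "c y"; simp; presburger)
  have f_less: "f x < 2 * t - 2" for x
  proof -
    have "2 * q (p x) + 1 < 2 * t - 2"
      using q_less[of "p x"] by linarith
    then show ?thesis
      by (simp add: f_def)
  qed
  have bound: "int (card C) \<le> \<lceil>(real t - 2) / 2\<rceil>" if C_comp: "mono_component V E f C" for C
  proof -
    obtain s v where v: "v \<in> V" "f v = s"
      and C: "C = {u. reach {v \<in> V. f v = s} (induced_edges E {v \<in> V. f v = s}) v u}"
      using C_comp unfolding mono_component_def is_component_def by blast
    have C_sub: "C \<subseteq> {v \<in> V. f v = s}"
      using reach_in unfolding C by fast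
    have "connected_graph C (induced_edges E {v \<in> V. f v = s})"
      unfolding C by (rule connected_graph_component)
    then have conn: "connected_graph C E"
      by (rule connected_graph_cong) (simp add: induced_edges_def)
    have same: "q (p x) = q (p y) \<and> c x = c y" if "x \<in> C" "y \<in> C" for x y
    proof (rule f_eq)
      show "f x = f y"
        using that C_sub by auto
    qed
    have "v \<in> C"
      using v by (simp add: C reach_refl)
    \<comment> \<open>An edge of \<open>C\<close> leaving the part of \<open>v\<close> would be
      monochromatic and so force different labels \<open>q\<close>, while equal values of
      \<open>f\<close> force equal ones.\<close>
    have "C \<inter> part V p (p v) = C"
    proof (rule ccontr)
      assume "C \<inter> part V p (p v) \<noteq> C"
      moreover have "C \<inter> part V p (p v) \<noteq> {}"
        using \<open>v \<in> C\<close> v(1) by (auto simp: part_def)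
      ultimately obtain x y where xy: "x \<in> C \<inter> part V p (p v)" "y \<in> C - C \<inter> part V p (p v)" "{x, y} \<in> E"
        using connected_graph_cut[OF conn, of "C \<inter> part V p (p v)"] by (metis inf_le1)
      then have "y \<in> V" "p x = p v" "p y \<noteq> p v" "x \<in> C" "y \<in> C"
        using C_sub by (auto simp: part_def)
      moreover have "mono_adjacent E c (part V p (p v)) (part V p (p y))"
        using xy same[of x y] \<open>y \<in> V\<close> unfolding mono_adjacent_def part_def by blast
      ultimately show False
        using q_proper[of "p v" "p y"] same[of x y] by simp
    qed
    then have "C \<subseteq> part V p (p v)" by blast
    moreover have "mono_connected E c C"
      using conn same unfolding mono_connected_def by blast
    ultimately have "card C \<le> (t - 1) div 2"
      by (rule card_mono_connected)
    \<comment> \<open>Rounding \<open>(t - 1) / 2\<close> down equals rounding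
      \<open>(t - 2) / 2\<close> up; \<open>t \<ge> 3\<close> makes the truncated subtraction
      harmless.\<close>
    moreover have "int ((t - 1) div 2) = \<lceil>(real t - 2) / 2\<rceil>"
    proof (rule ceiling_unique[symmetric])
      have "2 * ((t - 1) div 2) + 1 \<ge> t - 1" "2 * ((t - 1) div 2) \<le> t - 1"
        by linarith+
      then have "2 * real ((t - 1) div 2) \<ge> real t - 2" "2 * real ((t - 1) div 2) \<le> real t - 1"
        using assms(1) by linarith+
      then show "of_int (int ((t - 1) div 2)) - 1 < (real t - 2) / 2"
        "(real t - 2) / 2 \<le> of_int (int ((t - 1) div 2))"
        by simp_all
    qed
    ultimately show ?thesis by linarith
  qed
  show ?thesis
    using f_less bound by (intro exI[of _ "{..<2 * t - 2}"] exI[of _ f]) auto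
qed

end
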